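(* Let $n_1,\dots,n_i$ be positive integers such that $i \geq 2$, $\gcd(n_e,n_j) \neq 1$ for every $e \neq j$, $1 \leq e,j \leq i$, and let $n = n_1n_2\cdots n_i$. Let $m$ be a positive integer such that every prime factor of $n$ is a prime factor of $m$, and let $k = \gcd(n,m)$. For each $1 \leq j \leq i$, let $d_j = \gcd(m,n_j)$ and $n_j = q_jd_j$ for some positive integer $q_j$. Let $H$ be the abelian group $Z_{n_1}\times\cdots\times Z_{n_i}$. Then the following statements hold (degrees are taken in $m\text{-}G(H)$): (1) $H$ is not cyclic and $m\text{-}G(H)$ is connected. (2) $\deg((0,\dots,0)) = d_1d_2\cdots d_i - 1 \geq 2^i-1$. (3) Let $(a_1,\dots,a_i)\in H$. If $d_j \nmid a_j$ (in $\mathbb{Z}$) for some $1 \leq j \leq i$, then $\deg((a_1,\dots,a_i)) = 1$. (4) Let $(a_1,\dots,a_i)\in H\setminus\{(0,\dots,0)\}$. If $d_j \mid a_j$ for every $1 \leq j \leq i$, then $\deg((a_1,\dots,a_i)) = d_1d_2\cdots d_i+1$. (5) There are exactly $q_1q_2\cdots q_i - 1$ distinct elements in $H$ of degree $d_1d_2\cdots d_i+1$. (6) There are exactly $n - q_1q_2\cdots q_i$ distinct elements in $H$ of degree $1$. (7) $m\text{-}G(H)$ is a tree.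
   Context: $Z_r$ is the additive cyclic group of integers modulo $r$, with elements represented by the integers $0,\dots,r-1$; divisibility in $\mathbb{Z}$ refers to these representatives. For a finite abelian group $H$ (written additively) and an integer $m>1$, the graph $m\text{-}G(H)$ is the simple undirected graph with vertex set $H$ in which two distinct vertices $a,b$ are adjacent if and only if $ma=b$ or $mb=a$. *)

theory Defs
  imports
    "HOL-Algebra.Product_Groups"
    "HOL-Computational_Algebra.Primes"
    "Graph_Theory.Digraph_Component"
begin

text \<open>
  HOL-Algebra writes groups multiplicatively, so the multiple \<open>m a\<close> is the power
  \<open>a [^]\<^bsub>H\<^esub> m\<close>.  As usual in Graph_Theory, an undirected graph is a
  symmetric loop-free digraph in which every edge contributes both of its orientations; thus
  the number of neighbours of a vertex is its \<^const>\<open>out_degree\<close>.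
\<close>

definition mult_graph :: "nat \<Rightarrow> ('a, 'b) monoid_scheme \<Rightarrow> 'a pair_pre_digraph" where
  "mult_graph m H =
    \<lparr> pverts = carrier H,
      parcs = {(a, b). a \<in> carrier H \<and> b \<in> carrier H \<and> a \<noteq> b \<and>
                       (a [^]\<^bsub>H\<^esub> m = b \<or> b [^]\<^bsub>H\<^esub> m = a)} \<rparr>"

lemma pair_graph_mult_graph:
  assumes "finite (carrier H)"
  shows "pair_graph (mult_graph m H)"
proof -
  have "parcs (mult_graph m H) \<subseteq> carrier H \<times> carrier H"
    by (auto simp: mult_graph_def)
  then have "finite (parcs (mult_graph m H))"
    using assms by (meson finite_SigmaI finite_subset)
  then show ?thesis
    using assms by unfold_locales (auto simp: mult_graph_def symmetric_def intro!: symI)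
qed

text \<open>
  The constant \<^const>\<open>tree\<close> is not usable for symmetric digraphs: \<^const>\<open>forest\<close>
  forbids every \<^const>\<open>pre_digraph.cycle\<close>, including the closed walk
  \<open>a, b, a\<close> along a single edge.  A cycle of a simple undirected graph is a cycle of the
  symmetric digraph with at least three arcs.
\<close>

definition undirected_tree :: "('a, 'b) pre_digraph \<Rightarrow> bool" where
  "undirected_tree G \<longleftrightarrow>
    connected G \<and> \<not> (\<exists>p. pre_digraph.cycle G p \<and> length p \<ge> 3)"

end

theory Submission
  imports Defs "HOL-Number_Theory.Cong"
begin

text \<open>
  Adjacency in \<open>m-G(H)\<close> joins each element to its image under the single map
  \<open>f a = m a\<close>.  Every prime divisor of \<open>n\<close> divides \<open>m\<close>, so \<open>n\<close> divides some power
  \<open>m\<^sup>N\<close>; as \<open>n\<close> annihilates \<open>H\<close>, iterating \<open>f\<close> sends every element to \<open>0\<close>.  This alone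
  makes the graph a tree rooted at \<open>0\<close>, in which \<open>f a\<close> is the parent of \<open>a\<close>:
  following \<open>f\<close> connects every vertex to the root, and a deepest vertex of a cycle would
  have two different neighbours that are not deeper than itself, although its parent is the only such
  neighbour (\<open>no_long_cycle\<close>).

  In such a tree the neighbours of a vertex are its parent and its preimages under \<open>f\<close>; the
  root is its own preimage and has no other parent.  Hence degrees reduce to counting the
  solutions of \<open>m b = a\<close> in \<open>H\<close>.  This equation splits into one linear congruence per factor,
  which has \<open>d\<^sub>j\<close> solutions if \<open>d\<^sub>j\<close> divides \<open>a\<^sub>j\<close> and none
  otherwise (\<open>card_linear_congruence_solutions\<close>).  So an element other than \<open>0\<close> is either outside the
  image of \<open>f\<close>, and then a leaf, or it has degree \<open>d\<^sub>1 \<dots> d\<^sub>i + 1\<close>.  The root has degree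
  \<open>d\<^sub>1 \<dots> d\<^sub>i - 1\<close>, which lies strictly between \<open>1\<close> and \<open>d\<^sub>1 \<dots> d\<^sub>i + 1\<close> because every
  \<open>d\<^sub>j\<close> is at least \<open>2\<close> and there are at least two of them; this is why the root is counted in
  neither of the two classes.  The image of \<open>f\<close> has \<open>q\<^sub>1 \<dots> q\<^sub>i\<close> elements, the number of
  tuples of multiples of the \<open>d\<^sub>j\<close>.

  That \<open>H\<close> is not cyclic comes from two coordinates whose orders share a factor: no
  element has multiples that realise both unit vectors modulo that factor
  (\<open>not_cyclic_product_integer_mod_groups\<close>).
\<close>

section \<open>The graph of a map that contracts to a root\<close>

definition map_graph :: "'a set \<Rightarrow> ('a \<Rightarrow> 'a) \<Rightarrow> 'a pair_pre_digraph" where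
  "map_graph V f = \<lparr> pverts = V, parcs = {(a, b). a \<in> V \<and> b \<in> V \<and> a \<noteq> b \<and> (f a = b \<or> f b = a)} \<rparr>"

lemma mult_graph_eq_map_graph:
  "mult_graph m H = map_graph (carrier H) (\<lambda>a. a [^]\<^bsub>H\<^esub> m)"
  by (simp add: mult_graph_def map_graph_def)

text \<open>
  Some iterate of the map sends each point to the fixed point \<open>r\<close>.  For multiplication by
  \<open>m\<close> on a finite abelian group this is nilpotency, with \<open>r = 0\<close>.
\<close>

locale rooted_map =
  fixes V :: "'a set" and f :: "'a \<Rightarrow> 'a" and r :: 'a
  assumes root_in: "r \<in> V"
    and maps: "\<And>v. v \<in> V \<Longrightarrow> f v \<in> V"
    and root_fixed: "f r = r"
    and reaches_root: "\<And>v. v \<in> V \<Longrightarrow> \<exists>N. (f ^^ N) v = r"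
begin

abbreviation (input) "G \<equiv> with_proj (map_graph V f)"

definition depth :: "'a \<Rightarrow> nat" where
  "depth v = (LEAST N. (f ^^ N) v = r)"

lemma depth_step:
  assumes "v \<in> V" "v \<noteq> r"
  shows "depth v = Suc (depth (f v))"
proof -
  obtain N where N: "(f ^^ N) v = r" using reaches_root assms(1) by blast
  have "(LEAST N. (f ^^ N) v = r) = Suc (LEAST N. (f ^^ Suc N) v = r)"
    by (rule Least_Suc[where P = "\<lambda>N. (f ^^ N) v = r", OF N]) (use assms in simp)
  then show ?thesis by (simp add: depth_def funpow_Suc_right del: funpow.simps)
qed

lemma sym_digraph: "sym_digraph G"
  by unfold_locales (auto simp: map_graph_def symmetric_def intro!: symI)

lemma connected: "connected G"
proof -
  interpret sym_digraph G by (rule sym_digraph)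
  have to_root: "v \<rightarrow>\<^sup>*\<^bsub>G\<^esub> r" if "v \<in> V" for v
    using that
  proof (induction "depth v" arbitrary: v rule: less_induct)
    case less
    show ?case
    proof (cases "v = r")
      case True
      then have "v \<in> verts G" using root_in by (simp add: map_graph_def)
      with True show ?thesis by auto
    next
      case False
      then have s: "depth v = Suc (depth (f v))" using depth_step less.prems by blast
      then have "f v \<noteq> v" by auto
      then have "v \<rightarrow>\<^bsub>G\<^esub> f v" using less.prems maps by (simp add: map_graph_def)
      moreover have "f v \<rightarrow>\<^sup>*\<^bsub>G\<^esub> r" using less.hyps[of "f v"] s less.prems maps by simp
      ultimately show ?thesis by (rule adj_reachable_trans)
    qed
  qed
  have "u \<rightarrow>\<^sup>*\<^bsub>with_proj (mk_symmetric G)\<^esub> v" if "u \<in> V" "v \<in> V" for u v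
    using reachable_trans[OF to_root[OF that(1)] symmetric_reachable'[OF to_root[OF that(2)]]]
    by (rule reachable_mk_symmetricI)
  then show ?thesis
    using root_in by (auto simp: connected_def strongly_connected_def mk_symmetric_def map_graph_def)
qed

text \<open>
  A neighbour other than \<open>f v\<close> is a preimage of \<open>v\<close> and hence lies one level deeper.
\<close>

lemma shallower_neighbour_is_image:
  assumes "(v, w) \<in> parcs (map_graph V f) \<or> (w, v) \<in> parcs (map_graph V f)"
    and "depth w \<le> depth v"
  shows "w = f v"
proof (rule ccontr)
  assume "w \<noteq> f v"
  with assms(1) have w: "w \<in> V" "f w = v" "w \<noteq> v" by (auto simp: map_graph_def)
  then have "w \<noteq> r" using root_fixed by auto
  then show False using depth_step w assms(2) by fastforce
qed

text \<open>
  Both cycle neighbours of a deepest vertex of a cycle coincide with its image.  On a closed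
  walk of length two this is no contradiction; from length three on the two
  neighbours are distinct.
\<close>

lemma no_long_cycle:
  assumes "pre_digraph.cycle G p"
  shows "length p < 3"
proof (rule ccontr)
  assume "\<not> length p < 3"
  define L where "L = length p"
  have L: "L \<ge> 3" using \<open>\<not> length p < 3\<close> by (simp add: L_def)
  interpret sym_digraph G by (rule sym_digraph)
  obtain u where aw: "awalk u p u" and dist: "distinct (tl (awalk_verts u p))" and "p \<noteq> []"
    using assms by (auto simp: cycle_def)
  have cas: "cas u p u" and sub: "set p \<subseteq> parcs (map_graph V f)"
    using aw by (auto simp: awalk_def)
  define x where "x = (\<lambda>k. awalk_verts u p ! k)"
  have tails: "x k = fst (p ! k)" if "k < L" for k
    using that \<open>p \<noteq> []\<close> by (simp add: x_def L_def awalk_verts_conv nth_append)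
  have heads: "x (Suc k) = snd (p ! k)" if "k < L" for k
    using that \<open>p \<noteq> []\<close> by (simp add: x_def L_def awalk_verts_conv'[OF cas])
  have arc: "(x k, x (Suc k)) \<in> parcs (map_graph V f)" if "k < L" for k
  proof -
    have "p ! k \<in> parcs (map_graph V f)" using that sub nth_mem by (auto simp: L_def)
    then show ?thesis using that tails heads by simp
  qed
  have x0: "x 0 = u"
    using cas \<open>p \<noteq> []\<close> by (cases p) (auto simp: x_def)
  have xL: "x L = x 0"
    using awlast_if_cas[OF cas] x0 by (simp add: x_def last_conv_nth length_awalk_verts L_def)
  \<comment> \<open>Only the vertices \<open>x 1, \<dots>, x L\<close> are distinct: \<open>x 0\<close> repeats \<open>x L\<close>.\<close>
  have inj: "j = k" if "x j = x k" "1 \<le> j" "j \<le> L" "1 \<le> k" "k \<le> L" for j k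
  proof -
    have "tl (awalk_verts u p) ! (j - 1) = tl (awalk_verts u p) ! (k - 1)"
      using that by (simp add: x_def nth_tl length_awalk_verts L_def)
    moreover have "j - 1 < length (tl (awalk_verts u p))" "k - 1 < length (tl (awalk_verts u p))"
      using that L by (auto simp: length_awalk_verts L_def)
    ultimately have "j - 1 = k - 1" using dist nth_eq_iff_index_eq by blast
    then show ?thesis using that by simp
  qed
  have "finite (depth ` x ` {1..L})" "depth ` x ` {1..L} \<noteq> {}" using L by auto
  then obtain k where k: "k \<in> {1..L}" "depth (x k) = Max (depth ` x ` {1..L})"
    using Max_in by (smt (verit) imageE)
  have deepest: "depth (x j) \<le> depth (x k)" if "j \<le> L" for j
  proof -
    have "\<exists>j'\<in>{1..L}. x j' = x j"
      using that L xL by (cases "j = 0") auto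
    then show ?thesis using k(2) by (metis Max_ge \<open>finite _\<close> image_eqI)
  qed
  \<comment> \<open>The successor of \<open>x k\<close> on the cycle; at the end it wraps around to index \<open>1\<close>,
    as \<open>x L = x 0\<close>.\<close>
  define s where "s = (if k = L then 1 else Suc k)"
  have prev: "x (k - 1) = f (x k)"
  proof (rule shallower_neighbour_is_image)
    show "(x k, x (k - 1)) \<in> parcs (map_graph V f) \<or> (x (k - 1), x k) \<in> parcs (map_graph V f)"
    proof -
      have "k - 1 < L" "Suc (k - 1) = k" using k(1) by auto
      then show ?thesis using arc[of "k - 1"] by simp
    qed
    show "depth (x (k - 1)) \<le> depth (x k)" using k(1) by (intro deepest) auto
  qed
  have "(x k, x s) \<in> parcs (map_graph V f)"
    using arc[of "if k = L then 0 else k"] k(1) L xL by (auto simp: s_def split: if_splits)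
  then have succ: "x s = f (x k)"
    using deepest[of s] k(1) L by (intro shallower_neighbour_is_image) (auto simp: s_def)
  \<comment> \<open>The index of the predecessor, moved into \<open>{1..L}\<close>, where \<open>x\<close> is injective.\<close>
  define t where "t = (if k = 1 then L else k - 1)"
  have "x t = x s" using prev succ xL by (auto simp: t_def split: if_splits)
  then have "t = s" using inj[of t s] k(1) L by (auto simp: t_def s_def split: if_splits)
  then show False using k(1) L by (auto simp: t_def s_def split: if_splits)
qed

lemma out_degree_conv:
  "out_degree G v = card {b \<in> V. v \<in> V \<and> v \<noteq> b \<and> (f v = b \<or> f b = v)}"
proof -
  have "out_arcs G v = Pair v ` {b \<in> V. v \<in> V \<and> v \<noteq> b \<and> (f v = b \<or> f b = v)}"
    by (auto simp: out_arcs_def map_graph_def)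
  then show ?thesis by (simp add: out_degree_def card_image inj_on_def)
qed

lemma out_degree_root:
  "out_degree G r = card {b \<in> V. f b = r} - 1"
proof -
  have "{b \<in> V. r \<in> V \<and> r \<noteq> b \<and> (f r = b \<or> f b = r)} = {b \<in> V. f b = r} - {r}"
    using root_in root_fixed by auto
  then show ?thesis using root_in root_fixed by (simp add: out_degree_conv card_Diff_singleton)
qed

text \<open>
  The extra neighbour is the parent \<open>f v\<close>.  It is not also a preimage of \<open>v\<close>, because depth
  decreases along \<open>f\<close> and so \<open>f\<close> has no orbit of period two.
\<close>

lemma out_degree_nonroot:
  assumes "finite V" "v \<in> V" "v \<noteq> r"
  shows "out_degree G v = card {b \<in> V. f b = v} + 1"
proof -
  have d: "depth v = Suc (depth (f v))" using assms depth_step by blast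
  then have "f v \<noteq> v" by auto
  have "f (f v) \<noteq> v"
  proof (cases "f v = r")
    case True
    then show ?thesis using root_fixed assms by simp
  next
    case False
    then have "depth (f v) = Suc (depth (f (f v)))" using depth_step maps assms by blast
    with d show ?thesis by auto
  qed
  have "{b \<in> V. v \<in> V \<and> v \<noteq> b \<and> (f v = b \<or> f b = v)} = insert (f v) {b \<in> V. f b = v}"
    using \<open>f v \<noteq> v\<close> assms maps by auto
  then show ?thesis using assms \<open>f (f v) \<noteq> v\<close> by (simp add: out_degree_conv)
qed

end

section \<open>Counting solutions of a linear congruence\<close>

lemma card_multiples:
  fixes d q :: nat
  assumes "d > 0"
  shows "card {x \<in> {0..<int (q * d)}. int d dvd x} = q"
proof -
  have "{x \<in> {0..<int (q * d)}. int d dvd x} = (\<lambda>t. int d * int t) ` {0..<q}"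
  proof (intro equalityI subsetI)
    fix x assume x: "x \<in> {x \<in> {0..<int (q * d)}. int d dvd x}"
    then obtain t where t: "x = int d * t" by auto
    with x assms have "t \<ge> 0" "t < int q" by (auto simp: zero_le_mult_iff mult.commute)
    then show "x \<in> (\<lambda>t. int d * int t) ` {0..<q}"
      using t by (intro image_eqI[of _ _ "nat t"]) auto
  qed (use assms in \<open>auto simp flip: of_nat_mult simp: mult.commute\<close>)
  moreover have "inj_on (\<lambda>t. int d * int t) {0..<q}" using assms by (auto simp: inj_on_def)
  ultimately show ?thesis by (simp add: card_image)
qed

lemma card_residue_class:
  fixes d q :: nat and c :: int
  assumes "q > 0"
  shows "card {x \<in> {0..<int (q * d)}. x mod int q = c mod int q} = d"
proof -
  let ?c = "c mod int q"
  have "{x \<in> {0..<int (q * d)}. x mod int q = ?c} = (\<lambda>t. ?c + int q * int t) ` {0..<d}"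
  proof (intro equalityI subsetI)
    fix x assume x: "x \<in> {x \<in> {0..<int (q * d)}. x mod int q = ?c}"
    have "x = ?c + int q * (x div int q)" using x mod_mult_div_eq[of x "int q"] by simp
    moreover have "0 \<le> x div int q" using x by (auto simp: pos_imp_zdiv_nonneg_iff assms)
    moreover have "x div int q < int d"
    proof (rule ccontr)
      assume "\<not> x div int q < int d"
      then have "int q * int d \<le> int q * (x div int q)" by (intro mult_left_mono) auto
      also have "\<dots> \<le> x" using mod_mult_div_eq[of x "int q"] assms
        by (smt (verit) of_nat_0_less_iff pos_mod_sign)
      finally show False using x by (simp add: mult.commute)
    qed
    ultimately show "x \<in> (\<lambda>t. ?c + int q * int t) ` {0..<d}"
      by (intro image_eqI[of _ _ "nat (x div int q)"]) auto
  next
    fix x assume "x \<in> (\<lambda>t. ?c + int q * int t) ` {0..<d}"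
    then obtain t where t: "t < d" "x = ?c + int q * int t" by auto
    have c: "0 \<le> ?c" "?c < int q" using assms by auto
    have "int q * (int t + 1) \<le> int q * int d"
      using t(1) by (intro mult_left_mono) auto
    then have "int q * int t + int q \<le> int (q * d)" by (simp add: distrib_left)
    then show "x \<in> {x \<in> {0..<int (q * d)}. x mod int q = ?c}"
      using t c by simp
  qed
  moreover have "inj_on (\<lambda>t. ?c + int q * int t) {0..<d}" using assms by (auto simp: inj_on_def)
  ultimately show ?thesis by (simp add: card_image)
qed

text \<open>
  Dividing the congruence by \<open>d = gcd m n\<close> leaves a coefficient that is invertible modulo
  \<open>n div d\<close>.  The solutions therefore form one residue class modulo \<open>n div d\<close>, which meets
  \<open>{0..<n}\<close> exactly \<open>d\<close> times.
\<close>

lemma card_linear_congruence_solutions: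
  fixes m n :: nat and a :: int
  assumes "n > 0" "0 \<le> a" "a < int n"
  shows "card {x \<in> {0..<int n}. int m * x mod int n = a}
           = (if int (gcd m n) dvd a then gcd m n else 0)"
proof (cases "int (gcd m n) dvd a")
  case False
  have "int (gcd m n) dvd int m * x mod int n" for x
    by (rule dvd_mod) auto
  with False have "{x \<in> {0..<int n}. int m * x mod int n = a} = {}" by blast
  then show ?thesis using False by (simp only: card.empty if_False)
next
  case True
  define d where "d = gcd m n"
  have d: "d > 0" using assms by (simp add: d_def)
  obtain m' q where mq: "m = m' * d" "n = q * d" "coprime m' q"
    using gcd_coprime_exists[of m n, folded d_def] d by blast
  obtain a' where a': "a = int d * a'" using True by (auto simp: d_def)
  have q: "q > 0" using assms mq by simp
  \<comment> \<open>\<open>u\<close> is the inverse of \<open>m div d\<close> modulo \<open>n div d\<close>.\<close>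
  obtain u where u: "[int m' * u = 1] (mod int q)"
    using cong_solve_coprime_int[of "int m'" "int q"] mq(3) by auto
  have "int m * x mod int n = a \<longleftrightarrow> x mod int q = (u * a') mod int q" for x
  proof -
    have "int m * x mod int n = a \<longleftrightarrow> [int m * x = a] (mod int n)"
      using assms by (simp add: cong_def)
    also have "\<dots> \<longleftrightarrow> [int m' * x = a'] (mod int q)"
    proof -
      have "int m * x - a = int d * (int m' * x - a')" "int n = int d * int q"
        by (simp_all add: mq a' algebra_simps)
      then show ?thesis using d by (simp add: cong_iff_dvd_diff)
    qed
    also have "\<dots> \<longleftrightarrow> [x = u * a'] (mod int q)"
    proof
      assume "[int m' * x = a'] (mod int q)"
      then have "[u * (int m' * x) = u * a'] (mod int q)" by (rule cong_scalar_left)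
      moreover have "[(int m' * u) * x = 1 * x] (mod int q)" using u by (rule cong_scalar_right)
      ultimately show "[x = u * a'] (mod int q)"
        by (simp add: cong_def mult.assoc mult.left_commute)
    next
      assume "[x = u * a'] (mod int q)"
      then have "[int m' * x = int m' * (u * a')] (mod int q)" by (rule cong_scalar_left)
      moreover have "[(int m' * u) * a' = 1 * a'] (mod int q)" using u by (rule cong_scalar_right)
      ultimately show "[int m' * x = a'] (mod int q)"
        by (simp add: cong_def mult.assoc)
    qed
    finally show ?thesis by (simp add: cong_def)
  qed
  then show ?thesis
    using card_residue_class[OF q, of d "u * a'"] True unfolding d_def[symmetric]
    by (simp only: mq(2)[symmetric] if_True)
qed

section \<open>Products of cyclic groups\<close>

text \<open>
  This turns the hypothesis on prime divisors into nilpotency of multiplication by \<open>m\<close>.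
\<close>

lemma dvd_power_if_prime_divisors_dvd:
  fixes n m :: nat
  assumes "n > 0" "\<And>p. prime p \<Longrightarrow> p dvd n \<Longrightarrow> p dvd m"
  shows "\<exists>N. n dvd m ^ N"
  using assms
proof (induction n rule: prime_divisors_induct)
  case zero
  then show ?case by simp
next
  case (unit x)
  then show ?case by auto
next
  case (factor p x)
  then obtain N where "x dvd m ^ N" by auto
  moreover have "p dvd m" using factor by simp
  ultimately have "p * x dvd m * m ^ N" by (rule mult_dvd_mono[rotated])
  then show ?case by (intro exI[of _ "Suc N"]) simp
qed

lemma nat_pow_product_group:
  "x [^]\<^bsub>product_group I G\<^esub> (k::nat) = (\<lambda>j\<in>I. x j [^]\<^bsub>G j\<^esub> k)"
  by (induction k) (auto simp: fun_eq_iff)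

lemma int_pow_product_group_apply:
  assumes "\<And>j. j \<in> I \<Longrightarrow> group (G j)" "x \<in> carrier (product_group I G)" "j \<in> I"
  shows "(x [^]\<^bsub>product_group I G\<^esub> (k::int)) j = x j [^]\<^bsub>G j\<^esub> k"
proof -
  have "group_hom (product_group I G) (G j) (\<lambda>x. x j)"
    using assms by (intro group_hom.intro group_hom_axioms.intro) (auto simp: hom_def)
  then show ?thesis using assms(2) by (rule group_hom.hom_int_pow)
qed

text \<open>
  If \<open>x\<close> generated the product, some \<open>k x\<close> would be \<open>1\<close> in coordinate \<open>e\<close> and \<open>0\<close>
  in coordinate \<open>j\<close>, and some \<open>l x\<close> would be \<open>1\<close> in coordinate \<open>j\<close>.  Modulo
  the common divisor \<open>g\<close> of the two orders, \<open>k\<close> is then invertible, so \<open>k x\<^sub>j = 0\<close> gives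
  \<open>x\<^sub>j = 0\<close>, which contradicts \<open>l x\<^sub>j = 1\<close> unless \<open>g = 1\<close>.
\<close>

lemma not_cyclic_product_integer_mod_groups:
  assumes "e \<in> I" "j \<in> I" "e \<noteq> j" "gcd (ns e) (ns j) \<noteq> 1"
  shows "\<not> cyclic_group (product_group I (\<lambda>j. integer_mod_group (ns j)))"
    (is "\<not> cyclic_group ?H")
proof
  interpret group ?H by simp
  assume "cyclic_group ?H"
  then obtain x where x: "x \<in> carrier ?H" and gen: "carrier ?H = range (\<lambda>k::int. x [^]\<^bsub>?H\<^esub> k)"
    by (auto simp: cyclic_group)
  define g where "g = int (gcd (ns e) (ns j))"
  have g: "g dvd int (ns e)" "g dvd int (ns j)" by (auto simp: g_def)
  have "\<exists>k. [k * x e = (if c = e then 1 else 0)] (mod g) \<and> [k * x j = (if c = j then 1 else 0)] (mod g)"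
    if "c \<in> {e, j}" for c
  proof -
    \<comment> \<open>For \<open>ns c = 1\<close> the vector below would not lie in the carrier, as \<open>1\<close> is not a
      reduced representative modulo \<open>1\<close>.\<close>
    have "ns c \<noteq> 1" using that assms by auto
    then have "(\<lambda>l\<in>I. if l = c then 1 else 0) \<in> carrier ?H"
      by auto
    then obtain k :: int where k: "x [^]\<^bsub>?H\<^esub> k = (\<lambda>l\<in>I. if l = c then 1 else 0)"
      using gen by (metis (no_types, lifting) imageE)
    have "(k * x l) mod int (ns l) = (if l = c then 1 else 0)" if "l \<in> I" for l
      using int_pow_product_group_apply[OF _ x that, of k] that
      by (simp add: k int_pow_integer_mod_group)
    moreover have "[k * x l = (k * x l) mod int (ns l)] (mod g)" if "l \<in> {e, j}" for l
      using g that by (auto simp: cong_def mod_mod_cancel)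
    ultimately have "[k * x l = (if l = c then 1 else 0)] (mod g)" if "l \<in> {e, j}" for l
      using that assms(1,2) by (metis empty_iff insert_iff)
    then show ?thesis by (intro exI[of _ k]) (simp add: eq_commute[of c])
  qed
  from this[of e] this[of j] obtain k l
    where k: "[k * x e = 1] (mod g)" "[k * x j = 0] (mod g)" and l: "[l * x j = 1] (mod g)"
    using assms(3) by auto
  \<comment> \<open>Regrouping the product \<open>(k x\<^sub>e) (l x\<^sub>j)\<close>, which is \<open>1\<close>, exhibits the vanishing factor
    \<open>k x\<^sub>j\<close>.\<close>
  have "[1 * 1 = (k * x e) * (l * x j)] (mod g)"
    using k l by (intro cong_mult) (auto simp: cong_sym)
  also have "(k * x e) * (l * x j) = (k * x j) * (x e * l)" by (simp add: algebra_simps)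
  also have "[\<dots> = 0 * (x e * l)] (mod g)" using k by (intro cong_mult) auto
  finally have "g dvd 1" by (simp add: cong_iff_dvd_diff)
  then show False using assms(4) by (simp add: g_def)
qed

section \<open>The multiplication graph of a product of cyclic groups\<close>

theorem theorem4p1:
  fixes i n m k :: nat
    and ns d q :: "nat \<Rightarrow> nat"
    and H :: "(nat \<Rightarrow> int) monoid"
    and G :: "(nat \<Rightarrow> int, (nat \<Rightarrow> int) \<times> (nat \<Rightarrow> int)) pre_digraph"
  assumes "i \<ge> 2"
    and "\<And>j. j \<in> {1..i} \<Longrightarrow> ns j > 0"
    and "\<And>e j. e \<in> {1..i} \<Longrightarrow> j \<in> {1..i} \<Longrightarrow> e \<noteq> j \<Longrightarrow> gcd (ns e) (ns j) \<noteq> 1"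
    and "n = (\<Prod>j\<in>{1..i}. ns j)"
    and "m > 0"
    and "\<And>p. prime p \<Longrightarrow> p dvd n \<Longrightarrow> p dvd m"
    and "k = gcd n m"
    and "\<And>j. j \<in> {1..i} \<Longrightarrow> d j = gcd m (ns j)"
    and "\<And>j. j \<in> {1..i} \<Longrightarrow> q j > 0"
    and "\<And>j. j \<in> {1..i} \<Longrightarrow> ns j = q j * d j"
    and "H = product_group {1..i} (\<lambda>j. integer_mod_group (ns j))"
    and "G = with_proj (mult_graph m H)"
  shows "(\<not> cyclic_group H \<and> connected G) \<and>
    (out_degree G (\<lambda>j\<in>{1..i}. 0) = (\<Prod>j\<in>{1..i}. d j) - 1 \<and>
      (\<Prod>j\<in>{1..i}. d j) - 1 \<ge> 2 ^ i - 1) \<and>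
    (\<forall>a\<in>carrier H. (\<exists>j\<in>{1..i}. \<not> int (d j) dvd a j) \<longrightarrow> out_degree G a = 1) \<and>
    (\<forall>a\<in>carrier H - {\<lambda>j\<in>{1..i}. 0}. (\<forall>j\<in>{1..i}. int (d j) dvd a j) \<longrightarrow>
      out_degree G a = (\<Prod>j\<in>{1..i}. d j) + 1) \<and>
    card {a \<in> carrier H. out_degree G a = (\<Prod>j\<in>{1..i}. d j) + 1} = (\<Prod>j\<in>{1..i}. q j) - 1 \<and>
    card {a \<in> carrier H. out_degree G a = 1} = n - (\<Prod>j\<in>{1..i}. q j) \<and>
    undirected_tree G"
proof -
  let ?I = "{1..i}"
  let ?f = "\<lambda>a. a [^]\<^bsub>H\<^esub> m"
  let ?zero = "\<lambda>j\<in>?I. 0 :: int"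
  let ?D = "\<Prod>j\<in>?I. d j"
  let ?image = "{a \<in> carrier H. \<forall>j\<in>?I. int (d j) dvd a j}"
  have two: "1 \<in> ?I" "2 \<in> ?I" using assms(1) by auto
  have carrier: "carrier H = (\<Pi>\<^sub>E j\<in>?I. {0..<int (ns j)})"
    unfolding assms(11) carrier_product_group
    by (rule PiE_cong) (use assms(2) in \<open>auto simp: carrier_integer_mod_group\<close>)
  have fin: "finite (carrier H)" by (simp add: carrier finite_PiE)
  have card_carrier: "card (carrier H) = n"
    by (simp add: carrier card_PiE assms(4))
  have zero: "?zero \<in> carrier H" using assms(2) by (auto simp: carrier)
  have pow: "a [^]\<^bsub>H\<^esub> l = (\<lambda>j\<in>?I. int l * a j mod int (ns j))" for a and l :: nat
    by (simp add: assms(11) nat_pow_product_group)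
  interpret H: group H by (simp add: assms(11))
  obtain N where N: "n dvd m ^ N"
    using dvd_power_if_prime_divisors_dvd[of n m] assms(2,4,6) by (auto simp: prod_pos)
  have iter: "(?f ^^ l) a = a [^]\<^bsub>H\<^esub> (m ^ l)" if "a \<in> carrier H" for a l
    using that by (induction l) (simp_all add: H.nat_pow_pow mult.commute)
  interpret rooted_map "carrier H" ?f ?zero
  proof
    show "\<exists>N. (?f ^^ N) a = ?zero" if "a \<in> carrier H" for a
    proof
      have "int (ns j) dvd int (m ^ N)" if "j \<in> ?I" for j
      proof -
        have "ns j dvd n" using that by (simp add: assms(4) dvd_prodI)
        then show ?thesis using N by (meson dvd_trans of_nat_dvd_iff)
      qed
      then have "a [^]\<^bsub>H\<^esub> (m ^ N) = ?zero"
        unfolding pow by (intro restrict_ext) (simp add: dvd_imp_mod_0)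
      then show "(?f ^^ N) a = ?zero" by (simp only: iter[OF that])
    qed
    show "?f a \<in> carrier H" if "a \<in> carrier H" for a
      using that by (rule H.nat_pow_closed)
    show "?f ?zero = ?zero" by (simp add: pow fun_eq_iff)
  qed (rule zero)
  have G: "G = with_proj (map_graph (carrier H) ?f)"
    by (simp add: assms(12) mult_graph_eq_map_graph)
  \<comment> \<open>The solutions of \<open>m b = a\<close> form the product of the coordinatewise solution sets.\<close>
  have fibre: "card {b \<in> carrier H. ?f b = a}
      = (if \<forall>j\<in>?I. int (d j) dvd a j then ?D else 0)" if "a \<in> carrier H" for a
  proof -
    have "{b \<in> carrier H. ?f b = a}
        = (\<Pi>\<^sub>E j\<in>?I. {x \<in> {0..<int (ns j)}. int m * x mod int (ns j) = a j})"
      using that by (auto simp: carrier pow PiE_iff fun_eq_iff extensional_def restrict_def)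
    then have "card {b \<in> carrier H. ?f b = a}
        = (\<Prod>j\<in>?I. card {x \<in> {0..<int (ns j)}. int m * x mod int (ns j) = a j})"
      by (simp add: card_PiE)
    also have "\<dots> = (\<Prod>j\<in>?I. if int (d j) dvd a j then d j else 0)"
    proof (rule prod.cong)
      fix j assume j: "j \<in> ?I"
      then have "0 \<le> a j" "a j < int (ns j)" using that by (auto simp: carrier PiE_iff)
      from card_linear_congruence_solutions[OF assms(2)[OF j] this, of m]
      show "card {x \<in> {0..<int (ns j)}. int m * x mod int (ns j) = a j}
          = (if int (d j) dvd a j then d j else 0)"
        by (simp only: assms(8)[OF j])
    qed simp
    also have "\<dots> = (if \<forall>j\<in>?I. int (d j) dvd a j then ?D else 0)"
      by (auto intro!: prod.cong prod_zero)
    finally show ?thesis .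
  qed
  \<comment> \<open>Two orders are never coprime and \<open>i \<ge> 2\<close>, so no \<open>ns j\<close> is \<open>1\<close>; a prime divisor of
    \<open>ns j\<close> also divides \<open>m\<close>.\<close>
  have d2: "d j \<ge> 2" if "j \<in> ?I" for j
  proof -
    have "\<exists>e\<in>?I. e \<noteq> j"
      by (intro bexI[of _ "if j = 1 then 2 else 1"]) (use two in auto)
    then obtain e where "e \<in> ?I" "e \<noteq> j" by blast
    then have "ns j \<noteq> 1" using assms(3)[of e j] that by auto
    then obtain p where p: "prime p" "p dvd ns j" using prime_factor_nat by blast
    then have "p dvd n" using that by (metis assms(4) dvd_prodI dvd_trans finite_atLeastAtMost)
    then have "p dvd d j" using p assms(6) that by (simp add: assms(8))
    moreover have "d j > 0" using assms(5,8) that by simp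
    ultimately show ?thesis using p(1) by (meson dvd_imp_le order_trans prime_ge_2_nat)
  qed
  have "(\<Prod>j\<in>?I. 2) \<le> ?D" by (rule prod_mono) (use d2 in auto)
  then have D: "2 ^ i \<le> ?D" by simp
  moreover have "(2::nat) ^ 2 \<le> 2 ^ i" using assms(1) by (intro power_increasing) auto
  ultimately have D4: "4 \<le> ?D" by simp
  have deg0: "out_degree G ?zero = ?D - 1"
    unfolding G out_degree_root fibre[OF zero] by auto
  have deg: "out_degree G a = (if \<forall>j\<in>?I. int (d j) dvd a j then ?D else 0) + 1"
    if "a \<in> carrier H" "a \<noteq> ?zero" for a
    unfolding G out_degree_nonroot[OF fin that] fibre[OF that(1)] ..
  have "?image = (\<Pi>\<^sub>E j\<in>?I. {x \<in> {0..<int (ns j)}. int (d j) dvd x})"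
    unfolding carrier set_eq_iff mem_Collect_eq PiE_iff by blast
  then have "card ?image = (\<Prod>j\<in>?I. card {x \<in> {0..<int (ns j)}. int (d j) dvd x})"
    by (simp add: card_PiE)
  also have "\<dots> = (\<Prod>j\<in>?I. q j)"
  proof (rule prod.cong)
    fix j assume j: "j \<in> ?I"
    then have "d j > 0" using d2[OF j] by linarith
    then show "card {x \<in> {0..<int (ns j)}. int (d j) dvd x} = q j"
      unfolding assms(10)[OF j] by (rule card_multiples)
  qed simp
  finally have image: "card ?image = (\<Prod>j\<in>?I. q j)" .
  have zero_image: "?zero \<in> ?image" using zero by auto
  have "{a \<in> carrier H. out_degree G a = ?D + 1} = ?image - {?zero}"
  proof (intro equalityI subsetI)
    fix a assume a: "a \<in> {a \<in> carrier H. out_degree G a = ?D + 1}"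
    then have "a \<noteq> ?zero" using deg0 D4 by auto
    then show "a \<in> ?image - {?zero}" using a deg D4 by (auto split: if_splits)
  qed (use deg in auto)
  then have count_high: "card {a \<in> carrier H. out_degree G a = ?D + 1} = (\<Prod>j\<in>?I. q j) - 1"
    using zero_image image by (simp only: card_Diff_singleton)
  have leaf: "out_degree G a = 1" if "a \<in> carrier H" "\<exists>j\<in>?I. \<not> int (d j) dvd a j" for a
  proof -
    have "a \<noteq> ?zero" using that(2) by auto
    then show ?thesis unfolding deg[OF that(1) \<open>a \<noteq> ?zero\<close>] using that(2) by auto
  qed
  have "{a \<in> carrier H. out_degree G a = 1} = carrier H - ?image"
  proof (intro equalityI subsetI)
    fix a assume a: "a \<in> {a \<in> carrier H. out_degree G a = 1}"
    then have "a \<noteq> ?zero" using deg0 D4 by auto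
    then show "a \<in> carrier H - ?image"
      using a deg[of a] D4 by (auto split: if_splits simp del: prod_zero_iff)
  qed (use leaf in auto)
  then have count_leaves: "card {a \<in> carrier H. out_degree G a = 1} = n - (\<Prod>j\<in>?I. q j)"
    using image card_carrier card_Diff_subset[of ?image "carrier H"] fin by simp
  have not_cyclic: "\<not> cyclic_group H"
    unfolding assms(11)
    by (rule not_cyclic_product_integer_mod_groups[OF two]) (use assms(3)[OF two] in auto)
  have conn: "connected G" using connected unfolding G .
  have tree: "undirected_tree G"
    using conn no_long_cycle unfolding undirected_tree_def G by (meson not_le)
  have "\<forall>a\<in>carrier H. (\<exists>j\<in>?I. \<not> int (d j) dvd a j) \<longrightarrow> out_degree G a = 1"
    using leaf by blast
  moreover have "\<forall>a\<in>carrier H - {?zero}. (\<forall>j\<in>?I. int (d j) dvd a j) \<longrightarrow> out_degree G a = ?D + 1"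
    using deg by simp
  moreover have "2 ^ i - 1 \<le> ?D - 1" using D by simp
  ultimately show ?thesis
    by (intro conjI not_cyclic conn deg0 count_high count_leaves tree)
qed

end
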